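(* For saturated directed spaces, the existence of a regular clock map is strictly stronger than the existence of a continuous, regular, additive, endpoint-reparametrization-invariant length function. That is: if a saturated directed space $X$ admits a regular clock map $p:X\to\vec S^1$, then $X$ admits such a length function; and there exists a saturated directed space $X$ which admits such a length function but admits no regular clock map $p:X\to\vec S^1$.
   Context: $\mathbf{Top}$ denotes either the category of $\Delta$-generated topological spaces (spaces whose topology is final with respect to all continuous maps from $[0,1]$, equivalently from topological simplices) or its full subcategory of $\Delta$-Hausdorff $\Delta$-generated spaces (those in which the image of every continuous map from $[0,1]$ is closed); the result is for either choice. The $\Delta$-kelleyfication is the right adjoint of the inclusion of $\Delta$-generated spaces into all topological spaces (same set, topology refined to the $\Delta$-generated one). $\mathcal I$ is the set of nondecreasing continuous maps $[0,1]\to[0,1]$ and $\mathcal I_0=\{\phi\in\mathcal I\mid\phi(0)=0,\phi(1)=1\}$. A directed space is a pair $X=(|X|,\vec P(X))$ with $|X|$ in $\mathbf{Top}$ and $\vec P(X)$ a set of continuous maps $[0,1]\to|X|$ (directed paths) containing all constant paths, closed under normalized composition ($(\gamma_1*_N\gamma_2)(t)=\gamma_1(2t)$ for $t\le 1/2$ and $\gamma_2(2t-1)$ for $t\ge 1/2$, when $\gamma_1(1)=\gamma_2(0)$) and under precomposition by elements of $\mathcal I$. A morphism $X\to Y$ is a continuous map $|X|\to|Y|$ sending directed paths to directed paths by postcomposition. $X$ is saturated if whenever $v:[0,1]\to|X|$ is continuous, $\phi\in\mathcal I_0$ and $v\circ\phi\in\vec P(X)$, then $v\in\vec P(X)$.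 $\vec P(X)$ carries the $\Delta$-kelleyfication of the compact-open topology. The directed circle $\vec S^1$ is $\mathbb R/\mathbb Z$ with directed paths the continuous $c:[0,1]\to\mathbb R/\mathbb Z$ admitting a nondecreasing continuous lift $[0,1]\to\mathbb R$. A regular clock map is a morphism of directed spaces $p:X\to\vec S^1$ with $X$ saturated such that for every $u\in\vec P(X)$, $p\circ u$ constant implies $u$ constant. A length function on $X$ is a function $L:\vec P(X)\to[0,\infty[$. It is additive if $L(u*_Nv)=L(u)+L(v)$ whenever $u(1)=v(0)$; endpoint-reparametrization-invariant if $L(u\circ\phi)=L(u)$ for all $u\in\vec P(X)$, $\phi\in\mathcal I_0$; continuous if it is continuous on $\vec P(X)$; regular if $L(u)=0$ if and only if $u$ is constant. *)

theory Defs
  imports "HOL-Analysis.Analysis"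
begin

section \<open>Delta-generated spaces\<close>

text \<open>Both conditions test a set against all continuous maps from \<open>[0,1]\<close> (predicate \<^const>\<open>pathin\<close>).\<close>

definition delta_open :: "'a topology \<Rightarrow> 'a set \<Rightarrow> bool" where
  "delta_open X U \<longleftrightarrow> U \<subseteq> topspace X \<and>
     (\<forall>g. pathin X g \<longrightarrow> openin (top_of_set {0..1}) {t \<in> {0..1}. g t \<in> U})"

definition delta_generated :: "'a topology \<Rightarrow> bool" where
  "delta_generated X \<longleftrightarrow> (\<forall>U. delta_open X U \<longrightarrow> openin X U)"

definition delta_hausdorff :: "'a topology \<Rightarrow> bool" where
  "delta_hausdorff X \<longleftrightarrow> (\<forall>g. pathin X g \<longrightarrow> closedin X (g ` {0..1}))"

definition delta_kelley :: "'a topology \<Rightarrow> 'a topology" where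
  "delta_kelley X = topology (delta_open X)"

lemma openin_imp_delta_open: "openin X U \<Longrightarrow> delta_open X U"
  unfolding delta_open_def pathin_def
  by (auto simp: openin_subset dest!: openin_continuous_map_preimage)

lemma openin_delta_kelley [simp]: "openin (delta_kelley X) = delta_open X"
proof -
  have "istopology (delta_open X)"
    unfolding istopology_def
  proof (intro conjI allI impI)
    fix S T assume "delta_open X S" "delta_open X T"
    moreover have "{t \<in> {0..1}. g t \<in> S \<inter> T} = {t \<in> {0..1}. g t \<in> S} \<inter> {t \<in> {0..1}. g t \<in> T}"
      for g :: "real \<Rightarrow> 'a" by auto
    ultimately show "delta_open X (S \<inter> T)"
      unfolding delta_open_def by (auto simp: openin_Int)
  next
    fix \<K> assume "\<forall>K\<in>\<K>. delta_open X K"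
    moreover have "{t \<in> {0..1}. g t \<in> \<Union>\<K>} = \<Union>((\<lambda>K. {t \<in> {0..1}. g t \<in> K}) ` \<K>)"
      for g :: "real \<Rightarrow> 'a" by auto
    ultimately show "delta_open X (\<Union>\<K>)"
      unfolding delta_open_def by (auto intro!: openin_Union)
  qed
  then show ?thesis
    by (simp add: delta_kelley_def topology_inverse')
qed

text \<open>The two admissible choices for the base category \<open>Top\<close>.\<close>

datatype top_choice = Delta_Generated | Delta_Hausdorff_Delta_Generated

fun in_Top :: "top_choice \<Rightarrow> 'a topology \<Rightarrow> bool" where
  "in_Top Delta_Generated X \<longleftrightarrow> delta_generated X"
| "in_Top Delta_Hausdorff_Delta_Generated X \<longleftrightarrow> delta_generated X \<and> delta_hausdorff X"


section \<open>Directed spaces\<close>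

text \<open>
  A map \<open>[0,1] \<rightarrow> X\<close> is encoded as a function on the reals that is \<^const>\<open>undefined\<close> outside
  \<open>[0,1]\<close> (as in \<open>FuncSet\<close>), so that equality of paths is equality of functions.
\<close>

definition paths :: "'a topology \<Rightarrow> (real \<Rightarrow> 'a) set" where
  "paths X = {u. pathin X u \<and> u \<in> extensional {0..1}}"

text \<open>\<open>reparam\<close> and \<open>reparam0\<close> are the sets \<open>\<I>\<close> and \<open>\<I>\<^sub>0\<close>; only the values on \<open>[0,1]\<close> matter.\<close>

definition reparam :: "(real \<Rightarrow> real) set" where
  "reparam = {\<phi>. continuous_on {0..1} \<phi> \<and> mono_on {0..1} \<phi> \<and> \<phi> \<in> {0..1} \<rightarrow> {0..1}}"

definition reparam0 :: "(real \<Rightarrow> real) set" where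
  "reparam0 = {\<phi> \<in> reparam. \<phi> 0 = 0 \<and> \<phi> 1 = 1}"

definition ncomp :: "(real \<Rightarrow> 'a) \<Rightarrow> (real \<Rightarrow> 'a) \<Rightarrow> real \<Rightarrow> 'a"  (infixr \<open>*\<^sub>N\<close> 75) where
  "u *\<^sub>N v = (\<lambda>t\<in>{0..1}. if t \<le> 1/2 then u (2 * t) else v (2 * t - 1))"

record 'a dspace =
  under :: "'a topology"
  dpaths :: "(real \<Rightarrow> 'a) set"

definition directed_space :: "top_choice \<Rightarrow> 'a dspace \<Rightarrow> bool" where
  "directed_space \<T> X \<longleftrightarrow>
     in_Top \<T> (under X) \<and>
     dpaths X \<subseteq> paths (under X) \<and>
     (\<forall>x \<in> topspace (under X). (\<lambda>t\<in>{0..1}. x) \<in> dpaths X) \<and>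
     (\<forall>u \<in> dpaths X. \<forall>v \<in> dpaths X. u 1 = v 0 \<longrightarrow> u *\<^sub>N v \<in> dpaths X) \<and>
     (\<forall>u \<in> dpaths X. \<forall>\<phi> \<in> reparam. compose {0..1} u \<phi> \<in> dpaths X)"

definition dmorphism :: "'a dspace \<Rightarrow> 'b dspace \<Rightarrow> ('a \<Rightarrow> 'b) \<Rightarrow> bool" where
  "dmorphism X Y f \<longleftrightarrow>
     continuous_map (under X) (under Y) f \<and>
     (\<forall>u \<in> dpaths X. compose {0..1} f u \<in> dpaths Y)"

definition saturated :: "'a dspace \<Rightarrow> bool" where
  "saturated X \<longleftrightarrow>
     (\<forall>v \<in> paths (under X). \<forall>\<phi> \<in> reparam0.
        compose {0..1} v \<phi> \<in> dpaths X \<longrightarrow> v \<in> dpaths X)"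

definition compact_open :: "'a topology \<Rightarrow> (real \<Rightarrow> 'a) topology" where
  "compact_open X =
     topology_generated_by
       {{u \<in> paths X. u ` K \<subseteq> U} | K U. compact K \<and> K \<subseteq> {0..1} \<and> openin X U}"

definition dpath_space :: "'a dspace \<Rightarrow> (real \<Rightarrow> 'a) topology" where
  "dpath_space X = delta_kelley (subtopology (compact_open (under X)) (dpaths X))"


section \<open>The directed circle and regular clock maps\<close>

definition int_cong :: "(real \<times> real) set" where
  "int_cong = {(x, y). x - y \<in> \<int>}"

definition RZ_proj :: "real \<Rightarrow> real set" where
  "RZ_proj x = int_cong `` {x}"

definition RZ :: "real set topology" where
  "RZ = topology (\<lambda>U. U \<subseteq> UNIV // int_cong \<and> open (RZ_proj -` U))"

lemma openin_RZ: "openin RZ U \<longleftrightarrow> U \<subseteq> UNIV // int_cong \<and> open (RZ_proj -` U)"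
proof -
  have "istopology (\<lambda>U. U \<subseteq> UNIV // int_cong \<and> open (RZ_proj -` U))"
    unfolding istopology_def by (auto simp: vimage_Union intro!: open_Int)
  then show ?thesis
    by (simp add: RZ_def topology_inverse')
qed

lemma quotient_map_RZ_proj: "quotient_map euclideanreal RZ RZ_proj"
proof -
  have *: "range RZ_proj = UNIV // int_cong"
    by (auto simp: RZ_proj_def quotient_def)
  then have "RZ_proj -` (UNIV // int_cong) = UNIV"
    by blast
  then have "openin RZ (UNIV // int_cong)"
    by (simp add: openin_RZ)
  then have "topspace RZ = UNIV // int_cong"
    by (meson openin_RZ openin_subset openin_topspace subset_antisym)
  with * show ?thesis
    by (auto simp: quotient_map_def openin_RZ vimage_def)
qed

definition directed_circle :: "real set dspace" where
  "directed_circle =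
     \<lparr>under = RZ,
      dpaths = {c \<in> paths RZ. \<exists>h. continuous_on {0..1} h \<and> mono_on {0..1} h \<and>
                                  (\<forall>t\<in>{0..1}. c t = RZ_proj (h t))}\<rparr>"

definition regular_clock_map :: "top_choice \<Rightarrow> 'a dspace \<Rightarrow> ('a \<Rightarrow> real set) \<Rightarrow> bool" where
  "regular_clock_map \<T> X p \<longleftrightarrow>
     directed_space \<T> X \<and> saturated X \<and>
     dmorphism X directed_circle p \<and>
     (\<forall>u \<in> dpaths X. compose {0..1} p u constant_on {0..1} \<longrightarrow> u constant_on {0..1})"


section \<open>Length functions\<close>

text \<open>A length function is only meaningful on \<open>dpaths X\<close>; its values elsewhere are irrelevant.\<close>

definition length_function :: "'a dspace \<Rightarrow> ((real \<Rightarrow> 'a) \<Rightarrow> real) \<Rightarrow> bool" where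
  "length_function X L \<longleftrightarrow> (\<forall>u \<in> dpaths X. 0 \<le> L u)"

definition additive_length :: "'a dspace \<Rightarrow> ((real \<Rightarrow> 'a) \<Rightarrow> real) \<Rightarrow> bool" where
  "additive_length X L \<longleftrightarrow>
     (\<forall>u \<in> dpaths X. \<forall>v \<in> dpaths X. u 1 = v 0 \<longrightarrow> L (u *\<^sub>N v) = L u + L v)"

definition reparam_invariant_length :: "'a dspace \<Rightarrow> ((real \<Rightarrow> 'a) \<Rightarrow> real) \<Rightarrow> bool" where
  "reparam_invariant_length X L \<longleftrightarrow>
     (\<forall>u \<in> dpaths X. \<forall>\<phi> \<in> reparam0. L (compose {0..1} u \<phi>) = L u)"

definition continuous_length :: "'a dspace \<Rightarrow> ((real \<Rightarrow> 'a) \<Rightarrow> real) \<Rightarrow> bool" where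
  "continuous_length X L \<longleftrightarrow> continuous_map (dpath_space X) euclideanreal L"

definition regular_length :: "'a dspace \<Rightarrow> ((real \<Rightarrow> 'a) \<Rightarrow> real) \<Rightarrow> bool" where
  "regular_length X L \<longleftrightarrow> (\<forall>u \<in> dpaths X. L u = 0 \<longleftrightarrow> u constant_on {0..1})"

definition good_length_function :: "'a dspace \<Rightarrow> ((real \<Rightarrow> 'a) \<Rightarrow> real) \<Rightarrow> bool" where
  "good_length_function X L \<longleftrightarrow>
     length_function X L \<and> continuous_length X L \<and> regular_length X L \<and>
     additive_length X L \<and> reparam_invariant_length X L"

lemma topspace_dpath_space:
  assumes "directed_space \<T> X"
  shows "topspace (dpath_space X) = dpaths X"
proof -
  have "paths (under X) = {u \<in> paths (under X). u ` {} \<subseteq> {}}" by auto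
  then have "topspace (compact_open (under X)) = paths (under X)"
    unfolding compact_open_def topology_generated_by_topspace
    using openin_empty compact_empty by blast
  then have "topspace (subtopology (compact_open (under X)) (dpaths X)) = dpaths X"
    using assms by (auto simp: directed_space_def)
  moreover have "topspace (delta_kelley Y) = topspace Y" for Y :: "(real \<Rightarrow> 'a) topology"
    by (metis delta_open_def openin_delta_kelley openin_imp_delta_open openin_topspace
        openin_subset subset_antisym)
  ultimately show ?thesis
    by (simp add: dpath_space_def)
qed

end

theory Submission
  imports Defs
begin

text \<open>
  A regular clock map \<open>p\<close> measures a directed path \<open>u\<close> by the increment of a nondecreasing lift of
  \<open>p \<circ> u\<close> to the reals; this increment depends continuously on \<open>u\<close> because it only changes by a small
  angle when \<open>p \<circ> u\<close> is perturbed uniformly.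

  The converse fails for a directed loop that can be filled in: give \<open>\<complex>\<^sup>3\<close> the constant paths and the
  counterclockwise paths on the unit circle of a coordinate line. The total angle is a good length
  function, but a continuous map from the contractible space \<open>\<complex>\<^sup>3\<close> to the circle has degree zero on
  the loop, so a clock map would be constant along it.
\<close>

section \<open>Uniqueness, concatenation and stability of real angles along a path\<close>

section \<open>Angular lifts\<close>

lemma cis_eq_iff: "cis a = cis b \<longleftrightarrow> (\<exists>n::int. a = b + 2 * pi * n)"
  by (simp add: complex_eq_iff flip: sin_cos_eq_iff) metis

text \<open>Two angles with the same \<open>cis\<close> differ by an integer multiple of
  \<open>2 * pi\<close>. Distinct multiples are at least \<open>2 * pi\<close> apart, and a
  continuous function with such discrete values is constant on a connected set.\<close>

lemma lift_diff_constant: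
  fixes h k :: "'a::topological_space \<Rightarrow> real"
  assumes S: "connected S" and h: "continuous_on S h" and k: "continuous_on S k"
    and eq: "\<And>t. t \<in> S \<Longrightarrow> cis (h t) = cis (k t)"
    and xy: "x \<in> S" "y \<in> S"
  shows "h x - k x = h y - k y"
proof -
  have "\<exists>e>0. \<forall>y. y \<in> S \<and> h y - k y \<noteq> h x - k x \<longrightarrow> e \<le> norm (h y - k y - (h x - k x))"
    if x: "x \<in> S" for x
  proof (intro exI[of _ "2 * pi"] conjI allI impI)
    fix y assume y: "y \<in> S \<and> h y - k y \<noteq> h x - k x"
    obtain m n :: int where "h x = k x + 2 * pi * m" "h y = k y + 2 * pi * n"
      using eq[of x] eq[of y] x y unfolding cis_eq_iff by blast
    moreover from this have "m \<noteq> n" using y by auto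
    then have "1 \<le> \<bar>real_of_int n - real_of_int m\<bar>"
      by linarith
    then have "2 * pi * 1 \<le> 2 * pi * \<bar>real_of_int n - real_of_int m\<bar>"
      by (intro mult_left_mono) auto
    ultimately show "2 * pi \<le> norm (h y - k y - (h x - k x))"
      by (simp add: abs_mult flip: right_diff_distrib)
  qed simp
  then have "(\<lambda>t. h t - k t) constant_on S"
    using S h k by (intro continuous_discrete_range_constant continuous_intros) auto
  then show ?thesis
    using xy by (auto simp: constant_on_def)
qed

text \<open>The second angle is shifted by \<open>h 1 - k 0\<close>, on which \<open>cis\<close> is
  1 by \<open>eq\<close>. The shift makes the two pieces meet at \<open>1/2\<close> and changes
  neither the points on the circle nor the increments.\<close>

lemma concat_lifts:
  assumes h: "continuous_on {0..1} h" "mono_on {0..1} h"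
    and k: "continuous_on {0..1} k" "mono_on {0..1} k"
    and eq: "cis (h 1) = cis (k 0)"
  obtains l where "continuous_on {0..1} l" "mono_on {0..1} l"
    "\<And>t. t \<in> {0..1} \<Longrightarrow> cis (l t) = (if t \<le> 1/2 then cis (h (2 * t)) else cis (k (2 * t - 1)))"
    "l 1 - l 0 = (h 1 - h 0) + (k 1 - k (0::real))"
proof -
  define l where "l t = (if t \<le> 1/2 then h (2 * t) else k (2 * t - 1) + (h 1 - k 0))" for t
  show thesis
  proof
    show "continuous_on {0..1} l"
      unfolding l_def
      by (intro continuous_on_cases_1 continuous_intros continuous_on_compose2[OF h(1)]
          continuous_on_compose2[OF k(1)]) auto
    show "mono_on {0..1} l"
    proof (rule mono_onI)
      fix r s :: real assume *: "r \<in> {0..1}" "s \<in> {0..1}" "r \<le> s"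
      show "l r \<le> l s"
      proof (cases "r \<le> 1/2 \<and> \<not> s \<le> 1/2")
        case True
        then have "h (2 * r) \<le> h 1" "k 0 \<le> k (2 * s - 1)"
          using * by (auto intro!: mono_onD[OF h(2)] mono_onD[OF k(2)])
        then show ?thesis
          using True by (simp add: l_def)
      next
        case False
        then show ?thesis
          using * by (auto simp: l_def intro!: mono_onD[OF h(2)] mono_onD[OF k(2)])
      qed
    qed
    show "cis (l t) = (if t \<le> 1/2 then cis (h (2 * t)) else cis (k (2 * t - 1)))" if "t \<in> {0..1}" for t
      using eq by (simp add: l_def flip: cis_mult cis_divide)
  qed (simp add: l_def)
qed

lemma mono_on_comp_reparam:
  assumes "continuous_on {0..1} h" "mono_on {0..1} (h::real \<Rightarrow> real)" "\<phi> \<in> reparam"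
  shows "continuous_on {0..1} (\<lambda>t. h (\<phi> t))" "mono_on {0..1} (\<lambda>t. h (\<phi> t))"
proof -
  have \<phi>: "continuous_on {0..1} \<phi>" "mono_on {0..1} \<phi>" "\<phi> ` {0..1} \<subseteq> {0..1}"
    using assms(3) by (auto simp: reparam_def)
  show "continuous_on {0..1} (\<lambda>t. h (\<phi> t))"
    using continuous_on_compose2[OF assms(1) \<phi>(1) \<phi>(3)] .
  show "mono_on {0..1} (\<lambda>t. h (\<phi> t))"
  proof (rule mono_onI)
    fix r s :: real assume rs: "r \<in> {0..1}" "s \<in> {0..1}" "r \<le> s"
    show "h (\<phi> r) \<le> h (\<phi> s)"
      using mono_onD[OF \<phi>(2) rs] rs(1,2) \<phi>(3) by (intro mono_onD[OF assms(2)]) blast+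
  qed
qed

text \<open>This is how saturation carries pointwise facts from \<open>v \<circ> \<phi>\<close> back
  to \<open>v\<close>.\<close>

lemma reparam0_surj:
  assumes "\<phi> \<in> reparam0" "t \<in> {0..1}"
  obtains s where "s \<in> {0..1}" "\<phi> s = t"
  using assms IVT'[of \<phi> 0 t 1] unfolding reparam0_def reparam_def by fastforce

definition angle_variation :: "(real \<Rightarrow> complex) \<Rightarrow> real" where
  "angle_variation w = (THE a. \<exists>r h. 0 < r \<and> continuous_on {0..1} h \<and>
     (\<forall>t\<in>{0..1}. w t = of_real r * cis (h t)) \<and> a = h 1 - h 0)"

text \<open>The value does not depend on the representation: the norm determines the radius, and two
  angles of the same path differ by a constant.\<close>

lemma angle_variation_eq:
  assumes "0 < r" "continuous_on {0..1} h" "\<And>t. t \<in> {0..1} \<Longrightarrow> w t = of_real r * cis (h t)"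
  shows "angle_variation w = h 1 - h 0"
  unfolding angle_variation_def
proof (rule the_equality)
  show "\<exists>r' k. 0 < r' \<and> continuous_on {0..1} k \<and>
     (\<forall>t\<in>{0..1}. w t = of_real r' * cis (k t)) \<and> h 1 - h 0 = k 1 - k 0"
    using assms by blast
next
  fix a assume "\<exists>r' k. 0 < r' \<and> continuous_on {0..1} k \<and>
     (\<forall>t\<in>{0..1}. w t = of_real r' * cis (k t)) \<and> a = k 1 - k 0"
  then obtain r' k where k: "0 < r'" "continuous_on {0..1} k"
     "\<And>t. t \<in> {0..1} \<Longrightarrow> w t = of_real r' * cis (k t)" "a = k 1 - k 0" by blast
  have "norm (w 0) = r"
    using assms(1) by (subst assms(3)) (auto simp: norm_mult)
  moreover have "norm (w 0) = r'"
    using k(1) by (subst k(3)) (auto simp: norm_mult)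
  ultimately have "cis (h t) = cis (k t)" if "t \<in> {0..1}" for t
    using assms(1) assms(3)[OF that] k(3)[OF that] by simp
  then have "h 1 - k 1 = h 0 - k 0"
    by (intro lift_diff_constant[of "{0..1}"] assms k) auto
  then show "a = h 1 - h 0"
    using k(4) by simp
qed

text \<open>If \<open>w'\<close> is uniformly close to \<open>w\<close>, the quotient
  \<open>w' / w\<close> stays near 1, where \<open>Arg\<close> is continuous and small.
  \<open>Arg\<close> of the quotient is then a continuous choice of the angle \<open>h' - h\<close>,
  so the two variations differ by the difference of its end values. The bound \<open>d\<close>
  depends only on \<open>r\<close> and \<open>e\<close>; the radius of \<open>w'\<close> is
  free.\<close>

lemma angle_variation_close:
  assumes "0 < r" "0 < e"
  obtains d where "0 < d"
    "\<And>w h w' r' h'. \<lbrakk>continuous_on {0..1} h; \<And>t. t \<in> {0..1} \<Longrightarrow> w t = of_real r * cis (h t);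
       0 < r'; continuous_on {0..1} h'; \<And>t. t \<in> {0..1} \<Longrightarrow> w' t = of_real r' * cis (h' t);
       \<And>t. t \<in> {0..1} \<Longrightarrow> dist (w' t) (w t) < d\<rbrakk>
     \<Longrightarrow> dist (angle_variation w') (angle_variation w) < e"
proof -
  have "isCont Arg 1"
    by (rule continuous_at_Arg) simp
  then have "\<exists>\<eta>>0. \<forall>z. dist z 1 < \<eta> \<longrightarrow> dist (Arg z) (Arg 1) < e / 2"
    unfolding continuous_at_eps_delta using half_gt_zero[OF assms(2)] by blast
  then obtain \<eta> where \<eta>: "\<eta> > 0" "\<And>z. dist z 1 < \<eta> \<Longrightarrow> \<bar>Arg z\<bar> < e / 2"
    by (auto simp: dist_real_def)
  \<comment> \<open>Dividing by \<open>w t\<close>, of norm \<open>r\<close>, turns \<open>d\<close>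
    into \<open>min \<eta> 1\<close>. The bound 1 keeps the quotient in the right half plane, off
    the branch cut of \<open>Arg\<close>; the bound \<open>\<eta>\<close> makes \<open>Arg\<close>
    small.\<close>
  define d where "d = min \<eta> 1 * r"
  show thesis
  proof
    show "0 < d"
      using assms \<eta> by (simp add: d_def)
    fix w w' :: "real \<Rightarrow> complex" and h h' :: "real \<Rightarrow> real" and r'
    assume h: "continuous_on {0..1} h" "\<And>t. t \<in> {0..1} \<Longrightarrow> w t = of_real r * cis (h t)"
      and h': "0 < r'" "continuous_on {0..1} h'" "\<And>t. t \<in> {0..1} \<Longrightarrow> w' t = of_real r' * cis (h' t)"
      and close: "\<And>t. t \<in> {0..1} \<Longrightarrow> dist (w' t) (w t) < d"
    define z where "z t = of_real (r' / r) * cis (h' t - h t)" for t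
    have z: "dist (z t) 1 < \<eta>" "z t \<notin> \<real>\<^sub>\<le>\<^sub>0" "cis (Arg (z t)) = cis (h' t - h t)"
      if t: "t \<in> {0..1}" for t
    proof -
      have w: "norm (w t) = r" "w t \<noteq> 0"
        using h(2)[OF t] assms(1) by (auto simp: norm_mult)
      have "z t = w' t / w t"
        using h(2)[OF t] h'(3)[OF t] by (simp add: z_def flip: cis_divide)
      then have "z t - 1 = (w' t - w t) / w t"
        using w(2) by (simp add: diff_divide_distrib)
      then have "norm (z t - 1) = dist (w' t) (w t) / r"
        by (simp add: norm_divide dist_norm w(1))
      also have "\<dots> < min \<eta> 1"
        unfolding pos_divide_less_eq[OF assms(1)] using close[OF t] unfolding d_def .
      finally have *: "norm (z t - 1) < \<eta>" "norm (z t - 1) < 1" by auto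
      show "dist (z t) 1 < \<eta>"
        using * by (simp add: dist_norm)
      show "z t \<notin> \<real>\<^sub>\<le>\<^sub>0"
        using *(2) abs_Re_le_cmod[of "z t - 1"] by (auto simp: complex_nonpos_Reals_iff)
      have "z t \<noteq> 0" "sgn (z t) = cis (h' t - h t)"
        using assms(1) h'(1) by (simp_all add: z_def sgn_mult sgn_of_real)
      then show "cis (Arg (z t)) = cis (h' t - h t)"
        by (simp add: cis_Arg)
    qed
    have "continuous_on {0..1} z"
      unfolding z_def by (intro continuous_intros h h')
    then have "continuous_on {0..1} (\<lambda>t. Arg (z t))"
      by (intro continuous_intros) (use z(2) in auto)
    then have "Arg (z 1) - (h' 1 - h 1) = Arg (z 0) - (h' 0 - h 0)"
      using z(3) h(1) h'(2) by (intro lift_diff_constant[of "{0..1}" "\<lambda>t. Arg (z t)" "\<lambda>t. h' t - h t"]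
          continuous_on_diff) auto
    then have "(h' 1 - h' 0) - (h 1 - h 0) = Arg (z 1) - Arg (z 0)"
      by simp
    moreover have "\<bar>Arg (z 1)\<bar> < e / 2" "\<bar>Arg (z 0)\<bar> < e / 2"
      by (intro \<eta>(2) z; simp)+
    ultimately show "dist (angle_variation w') (angle_variation w) < e"
      using angle_variation_eq[OF assms(1) h] angle_variation_eq[OF h']
      by (simp add: dist_real_def)
  qed
qed

section \<open>From an angle on directed paths to a good length function\<close>

section \<open>Angular length functions\<close>

text \<open>The Delta-kelleyfication only adds open sets, so compact-open sets remain open.\<close>

lemma openin_dpath_space_subbasic:
  assumes "directed_space \<T> X" "compact K" "K \<subseteq> {0..1}" "openin (under X) U"
  shows "openin (dpath_space X) {u \<in> dpaths X. u ` K \<subseteq> U}"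
proof -
  have "dpaths X \<subseteq> paths (under X)"
    using assms(1) by (simp add: directed_space_def)
  then have "{u \<in> dpaths X. u ` K \<subseteq> U} = {u \<in> paths (under X). u ` K \<subseteq> U} \<inter> dpaths X"
    by auto
  moreover have "openin (compact_open (under X)) {u \<in> paths (under X). u ` K \<subseteq> U}"
    unfolding compact_open_def by (intro topology_generated_by_Basis CollectI exI[of _ K] exI[of _ U] conjI refl assms)
  ultimately have "openin (subtopology (compact_open (under X)) (dpaths X)) {u \<in> dpaths X. u ` K \<subseteq> U}"
    unfolding openin_subtopology by blast
  then show ?thesis
    unfolding dpath_space_def openin_delta_kelley by (rule openin_imp_delta_open)
qed

lemma dpath_continuous_on:
  fixes f :: "'a \<Rightarrow> 'b::topological_space"
  assumes "directed_space \<T> X" "continuous_map (under X) euclidean f" "u \<in> dpaths X"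
  shows "continuous_on {0..1} (\<lambda>t. f (u t))"
proof -
  have "pathin (under X) u"
    using assms by (auto simp: directed_space_def paths_def)
  then have "continuous_map (top_of_set {0..1}) euclidean (f \<circ> u)"
    unfolding pathin_def using assms(2) continuous_map_compose by blast
  then show ?thesis
    by (simp add: o_def)
qed

lemma dpath_in_topspace:
  assumes "directed_space \<T> X" "u \<in> dpaths X" "t \<in> {0..1}"
  shows "u t \<in> topspace (under X)"
proof -
  have "pathin (under X) u"
    using assms by (auto simp: directed_space_def paths_def)
  then show ?thesis
    using path_image_subset_topspace assms(3) by fast
qed

text \<open>Closeness in the compact-open topology implies uniform closeness after \<open>f\<close>:
  \<open>[0,1]\<close> is covered by finitely many short intervals on which
  \<open>f \<circ> u\<close> moves by less than \<open>d / 2\<close>, and each interval gives one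
  subbasic condition on \<open>v\<close>.\<close>

lemma uniform_nhd_dpath_space:
  fixes f :: "'a \<Rightarrow> 'b::metric_space"
  assumes X: "directed_space \<T> X" and f: "continuous_map (under X) euclidean f"
    and u: "u \<in> dpaths X" and "0 < d"
  obtains N where "openin (dpath_space X) N" "u \<in> N"
    "\<And>v t. v \<in> N \<Longrightarrow> t \<in> {0..1} \<Longrightarrow> dist (f (v t)) (f (u t)) < d"
proof -
  have "uniformly_continuous_on {0..1} (\<lambda>t. f (u t))"
    using dpath_continuous_on[OF X f u] by (simp add: compact_uniformly_continuous)
  then have "\<exists>\<delta>>0. \<forall>t\<in>{0..1}. \<forall>s\<in>{0..1}. dist s t < \<delta> \<longrightarrow> dist (f (u s)) (f (u t)) < d / 2"
    using half_gt_zero[OF \<open>0 < d\<close>] unfolding uniformly_continuous_on_def by (elim allE[of _ "d / 2"] impE)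
  then obtain \<delta> where \<delta>: "\<delta> > 0"
    "\<And>s t. s \<in> {0..1} \<Longrightarrow> t \<in> {0..1} \<Longrightarrow> dist s t < \<delta> \<Longrightarrow> dist (f (u s)) (f (u t)) < d / 2"
    by blast
  have "\<exists>A. finite A \<and> A \<subseteq> {0..1} \<and> {0..1::real} \<subseteq> (\<Union>a\<in>A. ball a (\<delta> / 2))"
    using seq_compact_imp_totally_bounded[OF compact_imp_seq_compact[OF compact_Icc], rule_format,
        OF half_gt_zero[OF \<delta>(1)]] .
  then obtain A where A: "finite A" "A \<subseteq> {0..1::real}" "{0..1} \<subseteq> (\<Union>a\<in>A. ball a (\<delta> / 2))"
    by blast
  \<comment> \<open>Closed balls, because a subbasic set needs a compact \<open>K\<close>; half the
    radius keeps them within distance \<open>\<delta>\<close> of the centre.\<close>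
  define K where "K a = cball a (\<delta> / 2) \<inter> {0..1}" for a :: real
  define U where "U a = {x \<in> topspace (under X). f x \<in> ball (f (u a)) (d / 2)}" for a
  define N where "N = topspace (dpath_space X) \<inter> (\<Inter>a\<in>A. {v \<in> dpaths X. v ` K a \<subseteq> U a})"
  show thesis
  proof
    have "openin (under X) (U a)" for a
      unfolding U_def by (rule openin_continuous_map_preimage[OF f]) auto
    then have "openin (dpath_space X) {v \<in> dpaths X. v ` K a \<subseteq> U a}" for a
      by (intro openin_dpath_space_subbasic[OF X]) (auto simp: K_def)
    then have "openin (dpath_space X) (topspace (dpath_space X) \<inter> \<Inter>((\<lambda>a. {v \<in> dpaths X. v ` K a \<subseteq> U a}) ` A))"
      using A(1) by (intro openin_Int_Inter) auto
    then show "openin (dpath_space X) N"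
      by (simp add: N_def)
    have "u t \<in> U a" if "a \<in> A" "t \<in> K a" for a t
    proof -
      have "dist a t < \<delta>"
        using that(2) \<delta>(1) by (auto simp: K_def)
      moreover have "t \<in> {0..1}" "a \<in> {0..1}"
        using that A(2) by (auto simp: K_def)
      ultimately show ?thesis
        using \<delta>(2)[of a t] dpath_in_topspace[OF X u, of t] by (simp add: U_def)
    qed
    then show "u \<in> N"
      unfolding N_def topspace_dpath_space[OF X] using u by blast
    fix v t assume v: "v \<in> N" and t: "t \<in> {0..1::real}"
    obtain a where a: "a \<in> A" "t \<in> ball a (\<delta> / 2)"
      using A(3) t by blast
    then have "t \<in> K a"
      using t by (auto simp: K_def)
    moreover have "v ` K a \<subseteq> U a" "u ` K a \<subseteq> U a"
      using v \<open>u \<in> N\<close> a(1) by (simp_all add: N_def)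
    ultimately have "v t \<in> U a" "u t \<in> U a"
      by auto
    then have "dist (f (u a)) (f (v t)) < d / 2" "dist (f (u a)) (f (u t)) < d / 2"
      by (simp_all add: U_def)
    then show "dist (f (v t)) (f (u t)) < d"
      by (rule dist_triangle_half_r)
  qed
qed

text \<open>
  The values of \<open>f\<close> on constant paths are unrestricted, so that \<open>f\<close> may be a projection of a
  contractible space onto the plane; the constant paths over \<open>0\<close>, which have no angle, are isolated
  from the nonconstant ones.
\<close>
lemma good_length_if_angular:
  fixes f :: "'a \<Rightarrow> complex"
  assumes X: "directed_space \<T> X" and f: "continuous_map (under X) euclidean f"
    and lift: "\<And>u. u \<in> dpaths X \<Longrightarrow> u constant_on {0..1} \<or>
      (\<exists>h. continuous_on {0..1} h \<and> mono_on {0..1} h \<and> (\<forall>t\<in>{0..1}. f (u t) = cis (h t)))"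
    and reg: "\<And>u. u \<in> dpaths X \<Longrightarrow> (\<lambda>t. f (u t)) constant_on {0..1} \<Longrightarrow> u constant_on {0..1}"
  shows "\<exists>L. good_length_function X L"
proof -
  \<comment> \<open>A path starting over 0 has no angle; by \<open>zero\<close> below it is
    constant, so its length has to be 0.\<close>
  define L where "L u = (if f (u 0) = 0 then 0 else angle_variation (\<lambda>t. f (u t)))" for u
  \<comment> \<open>Values of \<open>cis\<close> are never 0, so the second alternative of
    \<open>lift\<close> is excluded.\<close>
  have zero: "u t = u 0" if "u \<in> dpaths X" "f (u 0) = 0" "t \<in> {0..1}" for u t
    using lift[OF that(1)] that(2,3) by (auto simp: constant_on_def)
  \<comment> \<open>A constant path has its own norm as radius and \<open>Arg\<close> as constant
    angle; every other path has radius 1.\<close>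
  have polar: "\<exists>r h. 0 < r \<and> continuous_on {0..1} h \<and> mono_on {0..1} h \<and>
      (\<forall>t\<in>{0..1}. f (u t) = of_real r * cis (h t))" if u: "u \<in> dpaths X" "f (u 0) \<noteq> 0" for u
    using lift[OF u(1)]
  proof
    assume "u constant_on {0..1}"
    then have const: "u t = u 0" if "t \<in> {0..1}" for t
      using that by (auto simp: constant_on_def)
    have "f (u t) = of_real (norm (f (u 0))) * cis (Arg (f (u 0)))" if "t \<in> {0..1}" for t
      unfolding const[OF that] using rcis_cmod_Arg[of "f (u 0)", unfolded rcis_def] by (rule sym)
    then show ?thesis
      using u(2) by (intro exI[of _ "norm (f (u 0))"] exI[of _ "\<lambda>_. Arg (f (u 0))"] conjI ballI)
        (simp_all only: zero_less_norm_iff not_False_eq_True continuous_on_const mono_on_def order_refl simp_thms)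
  next
    assume "\<exists>h. continuous_on {0..1} h \<and> mono_on {0..1} h \<and> (\<forall>t\<in>{0..1}. f (u t) = cis (h t))"
    then show ?thesis
      by (intro exI[of _ 1]) auto
  qed
  have "length_function X L"
    unfolding length_function_def
  proof
    fix u assume u: "u \<in> dpaths X"
    show "0 \<le> L u"
    proof (cases "f (u 0) = 0")
      case False
      then obtain r h where h: "0 < r" "continuous_on {0..1} h" "mono_on {0..1} h"
         "\<And>t. t \<in> {0..1} \<Longrightarrow> f (u t) = of_real r * cis (h t)"
        using polar[OF u] by blast
      then show ?thesis
        using angle_variation_eq[OF h(1,2,4)] mono_onD[OF h(3), of 0 1] False by (simp add: L_def)
    qed (simp add: L_def)
  qed
  moreover have "regular_length X L"
    unfolding regular_length_def
  proof
    fix u assume u: "u \<in> dpaths X"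
    show "L u = 0 \<longleftrightarrow> u constant_on {0..1}"
    proof (cases "f (u 0) = 0")
      case True
      have "u constant_on {0..1}"
        unfolding constant_on_def using zero[OF u True] by blast
      then show ?thesis
        using True by (simp add: L_def)
    next
      case False
      then obtain r h where h: "0 < r" "continuous_on {0..1} h" "mono_on {0..1} h"
         "\<And>t. t \<in> {0..1} \<Longrightarrow> f (u t) = of_real r * cis (h t)"
        using polar[OF u] by blast
      have L: "L u = h 1 - h 0"
        using angle_variation_eq[OF h(1,2,4)] False by (simp add: L_def)
      show ?thesis
      proof
        assume "L u = 0"
        \<comment> \<open>A nondecreasing angle with equal end values is constant.\<close>
        then have "h t = h 0" if "t \<in> {0..1}" for t
          using L mono_onD[OF h(3), of 0 t] mono_onD[OF h(3), of t 1] that by auto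
        then have "f (u t) = of_real r * cis (h 0)" if "t \<in> {0..1}" for t
          unfolding h(4)[OF that] using that by metis
        then show "u constant_on {0..1}"
          unfolding constant_on_def by (intro reg[OF u, unfolded constant_on_def]) blast
      next
        assume "u constant_on {0..1}"
        then have "f (u t) = of_real r * cis (h 0)" if "t \<in> {0..1}" for t
          using that h(4)[of 0] by (auto simp: constant_on_def)
        then show "L u = 0"
          using angle_variation_eq[of r "\<lambda>_. h 0" "\<lambda>t. f (u t)"] h(1) by (simp add: L_def)
      qed
    qed
  qed
  moreover have "additive_length X L"
    unfolding additive_length_def
  proof (intro ballI impI)
    fix u v assume u: "u \<in> dpaths X" and v: "v \<in> dpaths X" and uv: "u 1 = v 0"
    have start: "(u *\<^sub>N v) 0 = u 0"
      by (simp add: ncomp_def)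
    show "L (u *\<^sub>N v) = L u + L v"
    proof (cases "f (u 0) = 0")
      case True
      then show ?thesis
        using zero[OF u True, of 1] uv start by (simp add: L_def)
    next
      case False
      then obtain r h where h: "0 < r" "continuous_on {0..1} h" "mono_on {0..1} h"
         "\<And>t. t \<in> {0..1} \<Longrightarrow> f (u t) = of_real r * cis (h t)"
        using polar[OF u] by blast
      then have "f (v 0) \<noteq> 0"
        using h(4)[of 1] uv by simp
      then obtain r' k where k: "0 < r'" "continuous_on {0..1} k" "mono_on {0..1} k"
         "\<And>t. t \<in> {0..1} \<Longrightarrow> f (v t) = of_real r' * cis (k t)"
        using polar[OF v] by blast
      \<comment> \<open>The common point \<open>u 1 = v 0\<close> forces equal radii, after which
        the angles can be concatenated.\<close>
      have eq: "of_real r * cis (h 1) = of_real r' * cis (k 0)"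
        using h(4)[of 1] k(4)[of 0] uv by simp
      then have "norm (of_real r * cis (h 1)) = norm (of_real r' * cis (k 0))"
        by simp
      then have "r = r'"
        using h(1) k(1) by (simp add: norm_mult)
      with eq h(1) have eq': "cis (h 1) = cis (k 0)"
        by simp
      obtain l where l: "continuous_on {0..1} l" "mono_on {0..1} l"
        "\<And>t. t \<in> {0..1} \<Longrightarrow> cis (l t) = (if t \<le> 1/2 then cis (h (2 * t)) else cis (k (2 * t - 1)))"
        "l 1 - l 0 = (h 1 - h 0) + (k 1 - k 0)"
        by (rule concat_lifts[OF h(2,3) k(2,3) eq']) (rule that)
      have "f ((u *\<^sub>N v) t) = of_real r * cis (l t)" if "t \<in> {0..1}" for t
      proof (cases "t \<le> 1/2")
        case True
        then have "2 * t \<in> {0..1}" "(u *\<^sub>N v) t = u (2 * t)" "cis (l t) = cis (h (2 * t))"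
          using that l(3)[OF that] by (simp_all add: ncomp_def)
        then show ?thesis
          using h(4)[of "2 * t"] by (simp only:)
      next
        case False
        then have "2 * t - 1 \<in> {0..1}"
          using that by simp
        moreover have "(u *\<^sub>N v) t = v (2 * t - 1)" "cis (l t) = cis (k (2 * t - 1))"
          using False that by (simp add: ncomp_def) (simp only: l(3)[OF that] False if_False)
        ultimately show ?thesis
          using k(4)[of "2 * t - 1"] \<open>r = r'\<close> by (simp only:)
      qed
      then have "angle_variation (\<lambda>t. f ((u *\<^sub>N v) t)) = l 1 - l 0"
        by (rule angle_variation_eq[OF h(1) l(1)])
      then show ?thesis
        using angle_variation_eq[OF h(1,2,4)] angle_variation_eq[OF k(1,2,4)] l(4)
          False \<open>f (v 0) \<noteq> 0\<close> start by (simp add: L_def)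
    qed
  qed
  moreover have "reparam_invariant_length X L"
    unfolding reparam_invariant_length_def
  proof (intro ballI)
    fix u \<phi> assume u: "u \<in> dpaths X" and \<phi>: "\<phi> \<in> reparam0"
    then have \<phi>': "\<phi> \<in> reparam" "\<phi> 0 = 0" "\<phi> 1 = 1" "\<And>t. t \<in> {0..1} \<Longrightarrow> \<phi> t \<in> {0..1}"
      by (auto simp: reparam0_def reparam_def)
    show "L (compose {0..1} u \<phi>) = L u"
    proof (cases "f (u 0) = 0")
      case False
      then obtain r h where h: "0 < r" "continuous_on {0..1} h" "mono_on {0..1} h"
         "\<And>t. t \<in> {0..1} \<Longrightarrow> f (u t) = of_real r * cis (h t)"
        using polar[OF u] by blast
      have "angle_variation (\<lambda>t. f (compose {0..1} u \<phi> t)) = h (\<phi> 1) - h (\<phi> 0)"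
        using mono_on_comp_reparam(1)[OF h(2,3) \<phi>'(1)] h(4) \<phi>'(4)
        by (intro angle_variation_eq[OF h(1)]) (auto simp: compose_def)
      then show ?thesis
        using angle_variation_eq[OF h(1,2,4)] False \<phi>' by (simp add: L_def compose_def)
    qed (simp add: L_def compose_def \<phi>')
  qed
  moreover have "continuous_length X L"
    unfolding continuous_length_def mtopology_is_euclidean[symmetric] Met_TC.continuous_map_to_metric
      topspace_dpath_space[OF X]
  proof (intro ballI allI impI)
    fix u :: "real \<Rightarrow> 'a" and e :: real
    assume u: "u \<in> dpaths X" and "0 < e"
    have sub: "N \<subseteq> dpaths X" if "openin (dpath_space X) N" for N
      using openin_subset[OF that] topspace_dpath_space[OF X] by simp
    show "\<exists>N. openin (dpath_space X) N \<and> u \<in> N \<and> (\<forall>v\<in>N. L v \<in> Met_TC.mball (L u) e)"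
    proof (cases "f (u 0) = 0")
      case True
      \<comment> \<open>Within distance 1 of 0 the start of \<open>v\<close> is off the unit circle,
        so every \<open>v\<close> in \<open>N\<close> is constant and \<open>L\<close> vanishes on
        \<open>N\<close>.\<close>
      obtain N where N: "openin (dpath_space X) N" "u \<in> N"
        "\<And>v t. v \<in> N \<Longrightarrow> t \<in> {0..1} \<Longrightarrow> dist (f (v t)) (f (u t)) < 1"
        using uniform_nhd_dpath_space[OF X f u zero_less_one] by blast
      have "L v = 0" if "v \<in> N" for v
      proof -
        have v: "v \<in> dpaths X"
          using that sub[OF N(1)] by blast
        have "norm (f (v 0)) < 1"
          using N(3)[OF that, of 0] True by simp
        then have "\<not> (\<exists>h. \<forall>t\<in>{0..1}. f (v t) = cis (h t))"
          by force
        then have "v constant_on {0..1}"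
          using lift[OF v] by blast
        then show ?thesis
          using \<open>regular_length X L\<close> v by (simp add: regular_length_def)
      qed
      then show ?thesis
        using N(1,2) \<open>0 < e\<close> by (intro exI[of _ N]) auto
    next
      case False
      then obtain r h where h: "0 < r" "continuous_on {0..1} h"
         "\<And>t. t \<in> {0..1} \<Longrightarrow> f (u t) = of_real r * cis (h t)"
        using polar[OF u] by blast
      obtain d where d: "0 < d"
        "\<And>w h w' r' h'. \<lbrakk>continuous_on {0..1} h; \<And>t. t \<in> {0..1} \<Longrightarrow> w t = of_real r * cis (h t);
           0 < r'; continuous_on {0..1} h'; \<And>t. t \<in> {0..1} \<Longrightarrow> w' t = of_real r' * cis (h' t);
           \<And>t. t \<in> {0..1} \<Longrightarrow> dist (w' t) (w t) < d\<rbrakk>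
         \<Longrightarrow> dist (angle_variation w') (angle_variation w) < e"
        by (rule angle_variation_close[OF h(1) \<open>0 < e\<close>]) blast
      \<comment> \<open>The bound \<open>r\<close> keeps \<open>f (v 0)\<close> away from 0, so that
        \<open>L v\<close> is an angle variation too; the bound \<open>d\<close> makes it close to
        that of \<open>u\<close>.\<close>
      obtain N where N: "openin (dpath_space X) N" "u \<in> N"
        "\<And>v t. v \<in> N \<Longrightarrow> t \<in> {0..1} \<Longrightarrow> dist (f (v t)) (f (u t)) < min d r"
        using uniform_nhd_dpath_space[OF X f u, of "min d r"] d(1) h(1) by auto
      have "dist (L v) (L u) < e" if "v \<in> N" for v
      proof -
        have "norm (f (u 0)) = r"
          using h(1,3) by (simp add: norm_mult)
        then have v0: "f (v 0) \<noteq> 0"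
          using N(3)[OF that, of 0] by auto
        have v: "v \<in> dpaths X"
          using that sub[OF N(1)] by blast
        obtain r' h' where h': "0 < r'" "continuous_on {0..1} h'"
          "\<And>t. t \<in> {0..1} \<Longrightarrow> f (v t) = of_real r' * cis (h' t)"
          using polar[OF v v0] by blast
        have "dist (angle_variation (\<lambda>t. f (v t))) (angle_variation (\<lambda>t. f (u t))) < e"
          using N(3)[OF that] by (intro d(2)[OF h(2,3) h']) auto
        then show ?thesis
          using False v0 by (simp add: L_def)
      qed
      then show ?thesis
        using N(1,2) by (intro exI[of _ N]) (auto simp: dist_commute)
    qed
  qed
  ultimately show ?thesis
    unfolding good_length_function_def by blast
qed

section \<open>Embedding \<open>R/Z\<close> in the plane, and the forward implication\<close>

section \<open>Clock maps\<close>

lemma RZ_proj_eq_iff: "RZ_proj x = RZ_proj y \<longleftrightarrow> cis (2 * pi * x) = cis (2 * pi * y)"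
proof
  assume eq: "RZ_proj x = RZ_proj y"
  have "y \<in> RZ_proj x"
    unfolding eq by (simp add: RZ_proj_def int_cong_def)
  then have "x - y \<in> \<int>"
    by (simp add: RZ_proj_def int_cong_def)
  then have "cis (2 * pi * (x - y)) = 1"
    by (rule cis_multiple_2pi)
  then have "cis (2 * pi * x) / cis (2 * pi * y) = 1"
    by (simp add: cis_divide right_diff_distrib)
  then show "cis (2 * pi * x) = cis (2 * pi * y)"
    by simp
next
  assume "cis (2 * pi * x) = cis (2 * pi * y)"
  then obtain n :: int where "2 * pi * x = 2 * pi * y + 2 * pi * n"
    unfolding cis_eq_iff by blast
  then have "2 * pi * (x - (y + n)) = 0"
    by (simp add: algebra_simps)
  then have "x = y + n"
    by simp
  then have "x - z = (y - z) + n" for z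
    by simp
  then have "x - z \<in> \<int> \<longleftrightarrow> y - z \<in> \<int>" for z
    by (simp only: add_in_Ints_iff_right Ints_of_int)
  then show "RZ_proj x = RZ_proj y"
    by (auto simp: RZ_proj_def int_cong_def)
qed

text \<open>The standard identification of \<open>R/Z\<close> with the unit circle, turning real
  lifts into angles. The chosen representative is irrelevant on classes by
  \<open>RZ_proj_eq_iff\<close>, and the modulus is 1 on every argument.\<close>

definition circle_embed :: "real set \<Rightarrow> complex" where
  "circle_embed c = cis (2 * pi * (SOME x. c = RZ_proj x))"

lemma circle_embed_proj: "circle_embed (RZ_proj x) = cis (2 * pi * x)"
proof -
  have "RZ_proj x = RZ_proj (SOME y. RZ_proj x = RZ_proj y)"
    by (rule someI) (rule refl)
  then show ?thesis
    unfolding circle_embed_def by (simp only: RZ_proj_eq_iff)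
qed

lemma continuous_map_circle_embed: "continuous_map RZ euclidean circle_embed"
proof (rule continuous_compose_quotient_map[OF quotient_map_RZ_proj])
  have "circle_embed \<circ> RZ_proj = (\<lambda>x. cis (2 * pi * x))"
    by (simp add: fun_eq_iff circle_embed_proj)
  then show "continuous_map euclideanreal euclidean (circle_embed \<circ> RZ_proj)"
    by (simp add: continuous_intros)
qed

text \<open>The angular criterion applies to \<open>circle_embed \<circ> p\<close>: a nondecreasing
  lift of \<open>p \<circ> u\<close>, scaled by \<open>2 * pi\<close>, is the required angle. Since
  the embedding separates classes, a constant image makes \<open>p \<circ> u\<close> constant, and
  regularity of the clock does the rest.\<close>

lemma good_length_if_regular_clock:
  assumes "regular_clock_map \<T> X p"
  shows "\<exists>L. good_length_function X L"
proof (rule good_length_if_angular)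
  show "directed_space \<T> X"
    using assms by (simp add: regular_clock_map_def)
  have p: "continuous_map (under X) RZ p"
    and dp: "\<And>u. u \<in> dpaths X \<Longrightarrow> compose {0..1} p u \<in> dpaths directed_circle"
    and reg: "\<And>u. u \<in> dpaths X \<Longrightarrow> compose {0..1} p u constant_on {0..1} \<Longrightarrow> u constant_on {0..1}"
    using assms by (auto simp: regular_clock_map_def dmorphism_def directed_circle_def)
  show "continuous_map (under X) euclidean (circle_embed \<circ> p)"
    using p continuous_map_circle_embed by (rule continuous_map_compose)
  fix u assume u: "u \<in> dpaths X"
  obtain h where h: "continuous_on {0..1} h" "mono_on {0..1} h" "\<And>t. t \<in> {0..1} \<Longrightarrow> p (u t) = RZ_proj (h t)"
    using dp[OF u] by (auto simp: directed_circle_def compose_def)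
  have "continuous_on {0..1} (\<lambda>t. 2 * pi * h t)"
    by (intro continuous_intros h)
  moreover have "mono_on {0..1} (\<lambda>t. 2 * pi * h t)"
    using h(2) by (simp add: mono_on_def)
  moreover have "\<forall>t\<in>{0..1}. (circle_embed \<circ> p) (u t) = cis (2 * pi * h t)"
    using h(3) by (simp add: circle_embed_proj)
  ultimately show "u constant_on {0..1} \<or> (\<exists>h. continuous_on {0..1} h \<and> mono_on {0..1} h \<and>
      (\<forall>t\<in>{0..1}. (circle_embed \<circ> p) (u t) = cis (h t)))"
    by blast
  assume "(\<lambda>t. (circle_embed \<circ> p) (u t)) constant_on {0..1}"
  then obtain c where c: "\<And>t. t \<in> {0..1} \<Longrightarrow> circle_embed (p (u t)) = c"
    by (auto simp: constant_on_def)
  have "cis (2 * pi * h t) = c" if "t \<in> {0..1}" for t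
    using c[OF that] unfolding h(3)[OF that] circle_embed_proj .
  then have "p (u t) = RZ_proj (h 0)" if "t \<in> {0..1}" for t
    unfolding h(3)[OF that] RZ_proj_eq_iff using that by simp
  then show "u constant_on {0..1}"
    by (intro reg[OF u]) (auto simp: constant_on_def compose_def)
qed

section \<open>Membership of inner product spaces in both versions of \<open>Top\<close>\<close>

section \<open>Euclidean spaces are Delta-generated\<close>

text \<open>Prescribing \<open>y n\<close> at \<open>1 / (n + 1)\<close> and \<open>x\<close> at 0
  gives a continuous map on a compact set of reals, which Dugundji's theorem extends to the whole
  line.\<close>

lemma path_through_convergent_sequence:
  fixes x :: "'a::real_inner"
  assumes "y \<longlonglongrightarrow> x"
  obtains g where "path g" "g 0 = x" "\<And>n. g (1 / real (Suc n)) = y n"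
proof -
  define s :: "nat \<Rightarrow> real" where "s n = 1 / real (Suc n)" for n
  define C where "C = insert 0 (range s)"
  have s: "s \<longlonglongrightarrow> 0" "inj s"
    unfolding s_def using LIMSEQ_Suc lim_1_over_n by (blast, auto simp: inj_def)
  define f where "f t = (if t = 0 then x else y (inv s t))" for t
  have f: "f 0 = x" "f (s n) = y n" for n
    by (simp_all add: f_def inv_f_f[OF s(2)]) (simp add: s_def)
  have "compact C"
    unfolding C_def by (rule compact_sequence_with_limit[OF s(1)])
  have cont: "continuous (at t within C) f" if "t \<in> C" for t
  proof (cases "t islimpt C")
    \<comment> \<open>The only limit point of \<open>C\<close> is 0; at the isolated points
      continuity is automatic.\<close>
    case True
    then have t: "t = 0"
      unfolding C_def islimpt_insert using sequence_unique_limpt[OF s(1)] by blast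
    show ?thesis
      unfolding t continuous_within_eps_delta
    proof (intro allI impI)
      fix e :: real assume "e > 0"
      then obtain N where N: "\<And>n. n \<ge> N \<Longrightarrow> dist (y n) x < e"
        using assms unfolding lim_sequentially by blast
      have "n \<ge> N" if "s n < s N" for n
        using that by (simp add: s_def divide_simps split: if_splits)
      then show "\<exists>d>0. \<forall>t\<in>C. dist t 0 < d \<longrightarrow> dist (f t) (f 0) < e"
        using N \<open>e > 0\<close> by (intro exI[of _ "s N"]) (auto simp: C_def f, auto simp: s_def)
    qed
  next
    case False
    then have "at t within C = bot"
      by (simp only: trivial_limit_within) simp
    then show ?thesis
      by (simp only: continuous_bot)
  qed
  then have "continuous_on C f"
    by (simp add: continuous_on_eq_continuous_within)
  then obtain g where g: "continuous_on UNIV g" "\<And>t. t \<in> C \<Longrightarrow> g t = f t"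
    using Dugundji[of UNIV UNIV C f] compact_imp_closed[OF \<open>compact C\<close>] by auto
  show thesis
  proof
    show "path g"
      unfolding path_def using g(1) continuous_on_subset by blast
  qed (use g(2) f in \<open>auto simp: C_def s_def\<close>)
qed

text \<open>If \<open>x\<close> in \<open>U\<close> were not interior, some sequence outside
  \<open>U\<close> would converge to \<open>x\<close>. A path through this sequence starts in
  \<open>U\<close>, so it must stay there for small parameters, yet it leaves \<open>U\<close> at
  every \<open>1 / (n + 1)\<close>.\<close>

lemma delta_generated_euclidean: "delta_generated (euclidean :: 'a::real_inner topology)"
  unfolding delta_generated_def
proof (intro allI impI)
  fix U :: "'a set" assume U: "delta_open euclidean U"
  have "x \<in> interior U" if "x \<in> U" for x
  proof (rule ccontr)
    assume "x \<notin> interior U"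
    then have "x \<in> closure (- U)"
      by (simp add: closure_interior)
    then obtain y where y: "\<And>n. y n \<notin> U" "y \<longlonglongrightarrow> x"
      unfolding closure_sequential by auto
    obtain g where g: "path g" "g 0 = x" "\<And>n. g (1 / real (Suc n)) = y n"
      by (rule path_through_convergent_sequence[OF y(2)]) (rule that)
    have "pathin euclidean g"
      using g(1) by (simp add: pathin_def path_def)
    then have "openin (top_of_set {0..1}) {t \<in> {0..1}. g t \<in> U}"
      using U unfolding delta_open_def by blast
    moreover have "0 \<in> {t \<in> {0..1}. g t \<in> U}"
      using \<open>x \<in> U\<close> g(2) by simp
    ultimately obtain e where e: "e > 0" "\<And>t. t \<in> {0..1} \<Longrightarrow> dist t 0 < e \<Longrightarrow> g t \<in> U"
      unfolding openin_euclidean_subtopology_iff by blast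
    obtain n where "1 / real (Suc n) < e"
      using nat_approx_posE[OF e(1)] by auto
    then show False
      using e(2)[of "1 / real (Suc n)"] g(3) y(1) by auto
  qed
  then show "openin euclidean U"
    by (metis interior_subset open_interior open_openin subsetI subset_antisym)
qed

lemma delta_hausdorff_euclidean: "delta_hausdorff (euclidean :: 'a::t2_space topology)"
  unfolding delta_hausdorff_def
  by (auto simp: pathin_def intro!: compact_imp_closed compact_continuous_image)

section \<open>The separating example: a directed loop in a contractible space\<close>

section \<open>A space without clock map\<close>

text \<open>The angle \<open>h\<close> is real-valued, so a path may wind any number of times and
  may pause.\<close>

definition filled_circle :: "(complex \<times> complex \<times> complex) dspace" where
  "filled_circle =
     \<lparr>under = euclidean,
      dpaths = range (\<lambda>x. \<lambda>t\<in>{0..1}. x) \<union>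
        (\<lambda>h. \<lambda>t\<in>{0..1}. (cis (h t), 0, 0)) ` {h. continuous_on {0..1} h \<and> mono_on {0..1} h}\<rparr>"

lemma under_filled_circle [simp]: "under filled_circle = euclidean"
  by (simp add: filled_circle_def)

lemma const_in_filled_circle: "(\<lambda>t\<in>{0..1}. x) \<in> dpaths filled_circle"
  by (simp add: filled_circle_def)

lemma turn_in_filled_circle:
  "continuous_on {0..1} h \<Longrightarrow> mono_on {0..1} h \<Longrightarrow> (\<lambda>t\<in>{0..1}. (cis (h t), 0, 0)) \<in> dpaths filled_circle"
  by (simp add: filled_circle_def)

lemma filled_circle_cases:
  assumes "u \<in> dpaths filled_circle"
  obtains (const) x where "u = (\<lambda>t\<in>{0..1}. x)"
  | (turn) h where "continuous_on {0..1} h" "mono_on {0..1} h" "u = (\<lambda>t\<in>{0..1}. (cis (h t), 0, 0))"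
  using assms unfolding filled_circle_def by auto

text \<open>A constant path that meets a turning path lies on the circle and is a turn with constant
  angle, so the mixed cases reduce to concatenating two angles.\<close>

lemma ncomp_in_filled_circle:
  assumes u: "u \<in> dpaths filled_circle" and v: "v \<in> dpaths filled_circle" and uv: "u 1 = v 0"
  shows "u *\<^sub>N v \<in> dpaths filled_circle"
proof -
  have turns: "(\<lambda>t\<in>{0..1}. (cis (h t), 0, 0)) *\<^sub>N (\<lambda>t\<in>{0..1}. (cis (k t), 0, 0)) \<in> dpaths filled_circle"
    if hk: "continuous_on {0..1} h" "mono_on {0..1} h" "continuous_on {0..1} k" "mono_on {0..1} k"
      "cis (h 1) = cis (k 0)" for h k
  proof -
    obtain l where l: "continuous_on {0..1} l" "mono_on {0..1} l"
      "\<And>t. t \<in> {0..1} \<Longrightarrow> cis (l t) = (if t \<le> 1/2 then cis (h (2 * t)) else cis (k (2 * t - 1)))"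
      by (rule concat_lifts[OF hk]) (rule that)
    have "(\<lambda>t\<in>{0..1}. (cis (h t), 0::complex, 0::complex)) *\<^sub>N (\<lambda>t\<in>{0..1}. (cis (k t), 0, 0)) =
        (\<lambda>t\<in>{0..1}. (cis (l t), 0, 0))"
      using l(3) by (auto simp: ncomp_def fun_eq_iff)
    then show ?thesis
      using turn_in_filled_circle[OF l(1,2)] by simp
  qed
  show ?thesis
    using u
  proof (cases rule: filled_circle_cases)
    case u: (const x)
    show ?thesis
      using v
    proof (cases rule: filled_circle_cases)
      case (const y)
      then have "u *\<^sub>N v = (\<lambda>t\<in>{0..1}. x)"
        using u uv by (auto simp: ncomp_def fun_eq_iff)
      then show ?thesis
        by (simp only: const_in_filled_circle)
    next
      case (turn k)
      then have "u = (\<lambda>t\<in>{0..1}. (cis (k 0), 0, 0))"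
        using u uv by (simp add: fun_eq_iff)
      then show ?thesis
        using turns[of "\<lambda>_. k 0" k] turn by (simp add: mono_on_def)
    qed
  next
    case u: (turn h)
    show ?thesis
      using v
    proof (cases rule: filled_circle_cases)
      case (const y)
      then have "v = (\<lambda>t\<in>{0..1}. (cis (h 1), 0, 0))"
        using u uv by (simp add: fun_eq_iff)
      then show ?thesis
        using turns[of h "\<lambda>_. h 1"] u by (simp add: mono_on_def)
    next
      case (turn k)
      then show ?thesis
        using turns[OF u(1,2) turn(1,2)] u uv by simp
    qed
  qed
qed

lemma reparam_in_filled_circle:
  assumes u: "u \<in> dpaths filled_circle" and \<phi>: "\<phi> \<in> reparam"
  shows "compose {0..1} u \<phi> \<in> dpaths filled_circle"
proof -
  have range: "\<phi> t \<in> {0..1}" if "t \<in> {0..1}" for t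
    using \<phi> that by (auto simp: reparam_def)
  show ?thesis
    using u
  proof (cases rule: filled_circle_cases)
    case (const x)
    then have "compose {0..1} u \<phi> = (\<lambda>t\<in>{0..1}. x)"
      using range by (auto simp: compose_def fun_eq_iff)
    then show ?thesis
      by (simp only: const_in_filled_circle)
  next
    case (turn h)
    then have "compose {0..1} u \<phi> = (\<lambda>t\<in>{0..1}. (cis (h (\<phi> t)), 0, 0))"
      using range by (auto simp: compose_def fun_eq_iff)
    then show ?thesis
      using turn_in_filled_circle[OF mono_on_comp_reparam[OF turn(1,2) \<phi>]] by (simp only:)
  qed
qed

lemma dpaths_filled_circle_subset: "dpaths filled_circle \<subseteq> paths (under filled_circle)"
proof
  fix u assume "u \<in> dpaths filled_circle"
  then show "u \<in> paths (under filled_circle)"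
  proof (cases rule: filled_circle_cases)
    case (const x)
    have "continuous_on {0..1} u"
      unfolding const by (rule continuous_on_eq[OF continuous_on_const]) simp
    then show ?thesis
      using const by (simp add: paths_def pathin_def)
  next
    case (turn h)
    have "continuous_on {0..1} (\<lambda>t. (cis (h t), 0::complex, 0::complex))"
      by (intro continuous_intros turn)
    then have "continuous_on {0..1} u"
      unfolding turn by (rule continuous_on_eq) simp
    then show ?thesis
      using turn by (simp add: paths_def pathin_def)
  qed
qed

lemma directed_space_filled_circle: "directed_space \<T> filled_circle"
proof -
  have "in_Top \<T> (under filled_circle)"
    by (cases \<T>) (simp_all add: delta_generated_euclidean delta_hausdorff_euclidean)
  then show ?thesis
    unfolding directed_space_def
    using dpaths_filled_circle_subset const_in_filled_circle ncomp_in_filled_circle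
      reparam_in_filled_circle by blast
qed

text \<open>A nowhere zero map on the contractible interval has a continuous logarithm; norm 1 makes
  its real part vanish, and its imaginary part is the angle.\<close>

lemma continuous_unit_lift:
  fixes w :: "real \<Rightarrow> complex"
  assumes "continuous_on {0..1} w" "\<And>t. t \<in> {0..1} \<Longrightarrow> norm (w t) = 1"
  obtains k where "continuous_on {0..1} k" "\<And>t. t \<in> {0..1} \<Longrightarrow> w t = cis (k t)"
proof -
  have "w t \<noteq> 0" if "t \<in> {0..1}" for t
    using assms(2)[OF that] by auto
  then obtain g where g: "continuous_on {0..1} g" "\<And>t. t \<in> {0..1} \<Longrightarrow> w t = exp (g t)"
    using continuous_logarithm_on_contractible[OF assms(1) convex_imp_contractible] by auto
  show thesis
  proof
    show "continuous_on {0..1} (\<lambda>t. Im (g t))"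
      by (intro continuous_intros g)
    fix t :: real assume t: "t \<in> {0..1}"
    then have "Re (g t) = 0"
      using assms(2)[OF t] g(2)[OF t] by simp
    then show "w t = cis (Im (g t))"
      using g(2)[OF t] by (simp add: exp_eq_polar)
  qed
qed

text \<open>As \<open>\<phi>\<close> is onto, \<open>v\<close> takes the same values as
  \<open>v \<circ> \<phi>\<close>. In the turning case \<open>v\<close> has a continuous angle
  \<open>k\<close>, and \<open>k \<circ> \<phi>\<close> differs from the given nondecreasing angle
  \<open>h\<close> by a constant, so \<open>k\<close> inherits monotonicity.\<close>

lemma saturated_filled_circle: "saturated filled_circle"
  unfolding saturated_def
proof (intro ballI impI)
  fix v \<phi> assume v: "v \<in> paths (under filled_circle)" and \<phi>: "\<phi> \<in> reparam0"
    and v\<phi>: "compose {0..1} v \<phi> \<in> dpaths filled_circle"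
  have vc: "continuous_on {0..1} v" "v \<in> extensional {0..1}"
    using v by (auto simp: paths_def pathin_def)
  have \<phi>': "continuous_on {0..1} \<phi>" "\<phi> ` {0..1} \<subseteq> {0..1}" "mono_on {0..1} \<phi>"
    using \<phi> by (auto simp: reparam0_def reparam_def)
  show "v \<in> dpaths filled_circle"
    using v\<phi>
  proof (cases rule: filled_circle_cases)
    case (const x)
    have v: "v t = x" if "t \<in> {0..1}" for t
    proof -
      obtain s where "s \<in> {0..1}" "\<phi> s = t"
        using reparam0_surj[OF \<phi> \<open>t \<in> {0..1}\<close>] .
      then show ?thesis
        using fun_cong[OF const, of s] by (simp add: compose_def)
    qed
    have "v = (\<lambda>t\<in>{0..1}. x)"
      by (rule extensionalityI[OF vc(2) restrict_extensional]) (simp add: v)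
    then show ?thesis
      by (simp only: const_in_filled_circle)
  next
    case (turn h)
    have v\<phi>: "v (\<phi> s) = (cis (h s), 0, 0)" if "s \<in> {0..1}" for s
      using fun_cong[OF turn(3), of s] that by (simp add: compose_def)
    have v: "norm (fst (v t)) = 1" "snd (v t) = (0, 0)" if t: "t \<in> {0..1}" for t
    proof -
      obtain s where "s \<in> {0..1}" "\<phi> s = t"
        using reparam0_surj[OF \<phi> t] .
      then show "norm (fst (v t)) = 1" "snd (v t) = (0, 0)"
        using v\<phi>[of s] by auto
    qed
    have "continuous_on {0..1} (\<lambda>t. fst (v t))"
      by (intro continuous_intros vc)
    then obtain k where k: "continuous_on {0..1} k" "\<And>t. t \<in> {0..1} \<Longrightarrow> fst (v t) = cis (k t)"
      using continuous_unit_lift v(1) by blast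
    have "continuous_on {0..1} (\<lambda>s. k (\<phi> s))"
      using continuous_on_compose2[OF k(1) \<phi>'(1,2)] .
    moreover have "cis (k (\<phi> s)) = cis (h s)" if "s \<in> {0..1}" for s
      using k(2)[of "\<phi> s"] v\<phi>[OF that] \<phi>'(2) that by force
    ultimately have diff: "k (\<phi> r) - h r = k (\<phi> s) - h s" if "r \<in> {0..1}" "s \<in> {0..1}" for r s
      using lift_diff_constant[of "{0..1}" "\<lambda>s. k (\<phi> s)" h r s] turn(1) that by simp
    have "mono_on {0..1} k"
    proof (rule mono_onI)
      fix a b :: real assume ab: "a \<in> {0..1}" "b \<in> {0..1}" "a \<le> b"
      obtain r where r: "r \<in> {0..1}" "\<phi> r = a"
        using reparam0_surj[OF \<phi> ab(1)] .
      obtain s where s: "s \<in> {0..1}" "\<phi> s = b"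
        using reparam0_surj[OF \<phi> ab(2)] .
      show "k a \<le> k b"
      proof (cases "r \<le> s")
        case True
        then show ?thesis
          using diff[OF r(1) s(1)] mono_onD[OF turn(2) r(1) s(1)] r(2) s(2) by simp
      next
        \<comment> \<open>Preimages in the wrong order can occur only if
          \<open>a = b\<close>.\<close>
        case False
        then have "b \<le> a"
          using mono_onD[OF \<phi>'(3) s(1) r(1)] r(2) s(2) by simp
        then show ?thesis
          using ab(3) by simp
      qed
    qed
    have "v = (\<lambda>t\<in>{0..1}. (cis (k t), 0, 0))"
      by (rule extensionalityI[OF vc(2) restrict_extensional]) (simp add: prod_eq_iff k(2) v(2))
    then show ?thesis
      using turn_in_filled_circle[OF k(1) \<open>mono_on {0..1} k\<close>] by (simp only:)
  qed
qed

lemma good_length_filled_circle: "\<exists>L. good_length_function filled_circle L"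
proof (rule good_length_if_angular)
  \<comment> \<open>The notion of a good length function does not mention \<open>\<T>\<close>, so
    either choice of \<open>Top\<close> serves for both.\<close>
  show "directed_space Delta_Generated filled_circle"
    by (rule directed_space_filled_circle)
  show "continuous_map (under filled_circle) euclidean fst"
    by (simp add: continuous_on_fst)
  fix u assume u: "u \<in> dpaths filled_circle"
  then show "u constant_on {0..1} \<or> (\<exists>h. continuous_on {0..1} h \<and> mono_on {0..1} h \<and>
      (\<forall>t\<in>{0..1}. fst (u t) = cis (h t)))"
  proof (cases rule: filled_circle_cases)
    case (const x)
    then show ?thesis
      unfolding constant_on_def by (intro disjI1 exI[of _ x]) simp
  next
    case (turn h)
    then show ?thesis
      by (intro disjI2 exI[of _ h]) simp
  qed
  assume const_fst: "(\<lambda>t. fst (u t)) constant_on {0..1}"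
  show "u constant_on {0..1}"
    using u
  proof (cases rule: filled_circle_cases)
    case (const x)
    then show ?thesis
      unfolding constant_on_def by (intro exI[of _ x]) simp
  next
    case (turn h)
    \<comment> \<open>The last two coordinates of a turning path are 0, so its first coordinate
      determines it.\<close>
    then show ?thesis
      using const_fst by (auto simp: constant_on_def)
  qed
qed

text \<open>The clock, seen in the plane, has a logarithm on the whole contractible space. Along the
  loop this gives an angle with equal end values, so the nondecreasing lift of the clock also has
  equal end values and is constant, against regularity.\<close>

lemma no_regular_clock_filled_circle: "\<not> regular_clock_map \<T> filled_circle p"
proof
  assume "regular_clock_map \<T> filled_circle p"
  then have p: "continuous_map euclidean RZ p"
    and dp: "\<And>u. u \<in> dpaths filled_circle \<Longrightarrow> compose {0..1} p u \<in> dpaths directed_circle"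
    and reg: "\<And>u. u \<in> dpaths filled_circle \<Longrightarrow> compose {0..1} p u constant_on {0..1} \<Longrightarrow> u constant_on {0..1}"
    by (auto simp: regular_clock_map_def dmorphism_def directed_circle_def)
  define f where "f x = circle_embed (p x)" for x
  have "continuous_map euclidean euclidean (circle_embed \<circ> p)"
    using p continuous_map_circle_embed by (rule continuous_map_compose)
  then have cont: "continuous_on UNIV f"
    by (simp add: f_def[abs_def] o_def)
  have "f x \<noteq> 0" for x
    by (simp add: f_def circle_embed_def)
  then obtain g where g: "continuous_on UNIV g" "\<And>x. f x = exp (g x)"
    using continuous_logarithm_on_contractible[OF cont convex_imp_contractible[OF convex_UNIV]] UNIV_I
    by metis
  have norm: "norm (f x) = 1" for x
    by (simp add: f_def circle_embed_def)
  define loop where "loop = (\<lambda>t\<in>{0..1::real}. (cis (2 * pi * t), 0::complex, 0::complex))"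
  have loop: "loop \<in> dpaths filled_circle"
    unfolding loop_def by (intro turn_in_filled_circle continuous_intros) (simp add: mono_on_def)
  obtain h where h: "continuous_on {0..1} h" "mono_on {0..1} h" "\<And>t. t \<in> {0..1} \<Longrightarrow> p (loop t) = RZ_proj (h t)"
    using dp[OF loop] by (auto simp: directed_circle_def compose_def)
  \<comment> \<open>Written without \<open>loop\<close>, which is restricted to
    \<open>[0,1]\<close>, so that continuity is immediate; \<open>k 1 = k 0\<close> because the loop
    is closed.\<close>
  define k where "k t = Im (g (cis (2 * pi * t), 0, 0))" for t :: real
  have "cis (2 * pi * h t) = cis (k t)" if t: "t \<in> {0..1}" for t
  proof -
    have "f (loop t) = cis (2 * pi * h t)"
      using h(3)[OF t] by (simp add: f_def circle_embed_proj)
    moreover have "Re (g (loop t)) = 0"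
      using norm[of "loop t"] g(2)[of "loop t"] by simp
    then have "f (loop t) = cis (Im (g (loop t)))"
      using g(2)[of "loop t"] by (simp add: exp_eq_polar)
    moreover have "Im (g (loop t)) = k t"
      using t by (simp add: k_def loop_def)
    ultimately show ?thesis
      by simp
  qed
  moreover have "continuous_on {0..1} k"
    unfolding k_def by (intro continuous_intros continuous_on_compose2[OF g(1)]) auto
  ultimately have "2 * pi * h 1 - k 1 = 2 * pi * h 0 - k 0"
    using h(1) by (intro lift_diff_constant[of "{0..1}" "\<lambda>t. 2 * pi * h t" k] continuous_intros) auto
  moreover have "k 1 = k 0"
    by (simp add: k_def)
  ultimately have "h 1 = h 0"
    by simp
  then have const: "h t = h 0" if "t \<in> {0..1}" for t
    using mono_onD[OF h(2), of 0 t] mono_onD[OF h(2), of t 1] that by simp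
  have "compose {0..1} p loop t = RZ_proj (h 0)" if "t \<in> {0..1}" for t
    using h(3)[OF that] const[OF that] that by (simp add: compose_def)
  then have "loop constant_on {0..1}"
    by (intro reg[OF loop]) (auto simp: constant_on_def)
  \<comment> \<open>These points have first coordinates 1 and -1.\<close>
  then have "loop 0 = loop (1/2)"
    by (auto simp: constant_on_def)
  then show False
    by (simp add: loop_def complex_eq_iff)
qed

theorem mainTheorem5:
  fixes \<T> :: top_choice
  shows "(\<forall>X :: 'a dspace. directed_space \<T> X \<and> saturated X \<and> (\<exists>p. regular_clock_map \<T> X p) \<longrightarrow>
            (\<exists>L. good_length_function X L)) \<and>
         (\<exists>X :: (complex \<times> complex \<times> complex) dspace. directed_space \<T> X \<and> saturated X \<and>
            (\<exists>L. good_length_function X L) \<and> \<not> (\<exists>p. regular_clock_map \<T> X p))"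
  using good_length_if_regular_clock directed_space_filled_circle saturated_filled_circle
    good_length_filled_circle no_regular_clock_filled_circle by meson

end
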